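(* Let $A\in\mathbb{R}^{m\times n}$ with $m\le n$ have rank $l$ and let $k$ be an integer with $0\le k\le l$. Then the following statements are equivalent: (1) There exists a Recoverable Support of $A$ with size $k$. (2) There exists $F\in\mathcal{F}_{n-k}(C^n)$ such that $\mathrm{relint}(F)\cap \mathrm{rg}(A^T)\neq\emptyset$ and $A_{I(F)}^T$ has full rank. (3) There exist $V\in\mathcal{F}_{l-k}(C^n\cap \mathrm{rg}(A^T))$ and $v\in V$ such that, with $I:=I(V)$, $\|v_{I^c}\|_\infty<1$ and $A_I$ has full rank.
   Context: For $A\in\mathbb{R}^{m\times n}$ and $I\subset\{1,\dots,n\}$, $A_I$ denotes the submatrix of $A$ formed by the columns indexed by $I$, $A_I^T$ its transpose, $I^c=\{1,\dots,n\}\setminus I$, and $v_I$ the restriction of a vector $v$ to $I$. $\mathrm{rg}(A^T)$ is the range of $A^T$. "$A_I$ has full rank" means that the columns of $A_I$ are linearly independent; "$A_I^T$ has full rank" means that the rows of $A_I^T$ are linearly independent. A sup-norm over an empty index set is $0$. A pair $(I,s)$ with $I\subset\{1,\dots,n\}$, $|I|\le m$, and $s\in\{-1,1\}^I$ is a Recoverable Support of $A$ of size $|I|$ if $A_I$ has full rank and there exists $w\in\mathbb{R}^m$ with $A_I^Tw=s$ and $\|A_{I^c}^Tw\|_\infty<1$ (the empty index set is allowed). $C^n=[-1,+1]^n$ is the hypercube. For a polytope $P$, $\mathcal{F}_j(P)$ is the set of its $j$-dimensional faces (with $P$ itself the face of dimension $\dim P$). For a nonempty subset $V\subset C^n$ (in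 particular a face of $C^n$ or of $C^n\cap\mathrm{rg}(A^T)$), $I(V)$ is the set of indices $i$ for which there is a sign $\sigma_i\in\{-1,1\}$ with $v_i=\sigma_i$ for all $v\in V$. A face $F\in\mathcal{F}_{n-k}(C^n)$ satisfies $|I(F)|=k$, and $\mathrm{relint}(F)=\{x\in F : |x_i|<1 \text{ for } i\notin I(F)\}$. *)

theory Defs
  imports "HOL-Analysis.Analysis"
begin

text \<open>
  Linear independence of the family \<open>(f i)\<close>, \<open>i \<in> I\<close>. Injectivity is needed because
  \<^const>\<open>independent\<close> speaks about sets and would not notice a repeated vector.
\<close>
definition lin_indep_family :: "('i \<Rightarrow> 'a::real_vector) \<Rightarrow> 'i set \<Rightarrow> bool" where
  "lin_indep_family f I \<longleftrightarrow> inj_on f I \<and> independent (f ` I)"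

definition columns_full_rank :: "real^'n^'m \<Rightarrow> 'n set \<Rightarrow> bool" where
  "columns_full_rank A I \<longleftrightarrow> lin_indep_family (\<lambda>i. column i A) I"

definition rows_full_rank :: "real^'m^'n \<Rightarrow> 'n set \<Rightarrow> bool" where
  "rows_full_rank B I \<longleftrightarrow> lin_indep_family (\<lambda>i. row i B) I"

text \<open>The sup-norm of the restriction of \<open>v\<close> to \<open>J\<close>; it is \<open>0\<close> for empty \<open>J\<close>.\<close>
definition supnorm_on :: "'n::finite set \<Rightarrow> real^'n \<Rightarrow> real" where
  "supnorm_on J v = Max (insert 0 ((\<lambda>i. \<bar>v $ i\<bar>) ` J))"

text \<open>
  The entries of \<open>transpose A *v w\<close> with index in \<open>J\<close> are the entries of \<open>A\<^sub>J\<^sup>T w\<close>.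
\<close>
definition recoverable_support :: "real^'n^'m \<Rightarrow> 'n set \<Rightarrow> ('n \<Rightarrow> real) \<Rightarrow> bool" where
  "recoverable_support A I s \<longleftrightarrow>
     card I \<le> CARD('m) \<and> s \<in> I \<rightarrow>\<^sub>E {-1, 1} \<and> columns_full_rank A I \<and>
     (\<exists>w :: real^'m. (\<forall>i\<in>I. (transpose A *v w) $ i = s i) \<and>
                     supnorm_on (- I) (transpose A *v w) < 1)"

definition hypercube :: "(real^'n) set" where
  "hypercube = {x. \<forall>i. x $ i \<in> {-1..1}}"

definition rg :: "real^'m^'n \<Rightarrow> (real^'n) set" where
  "rg B = range (\<lambda>w. B *v w)"

definition faces_of_dim :: "nat \<Rightarrow> 'a::euclidean_space set \<Rightarrow> 'a set set" where
  "faces_of_dim j P = {F. F face_of P \<and> aff_dim F = int j}"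

definition sign_index_set :: "(real^'n) set \<Rightarrow> 'n set" where
  "sign_index_set V = {i. \<exists>\<sigma>\<in>{-1, 1}. \<forall>v\<in>V. v $ i = \<sigma>}"

end

theory Submission
  imports Defs
begin

text \<open>
  Everything is read off from a single point \<open>x\<close> of the cube section \<open>C\<^sup>n \<inter> S\<close>, where \<open>S\<close> is a
  subspace: the smallest face containing \<open>x\<close> is obtained by freezing the coordinates in which
  \<open>x\<close> is \<open>\<plusminus>1\<close>, it has \<open>x\<close> in its relative interior, and every face arises
  in this way from its relative interior points. If \<open>S\<close> projects onto the \<open>k\<close> frozen coordinates,
  then this face has dimension \<open>dim S - k\<close>. For \<open>S = rg A\<^sup>T\<close> surjectivity of that projection
  follows from the linear independence of the corresponding columns of \<open>A\<close>. Hence all three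
  statements say that some \<open>x \<in> C\<^sup>n \<inter> rg A\<^sup>T\<close> has exactly \<open>k\<close> extreme coordinates, and that the
  columns of \<open>A\<close> at these coordinates are independent.
\<close>

section \<open>Faces of sections of the cube by a subspace\<close>

definition active :: "real^'n \<Rightarrow> 'n set" where
  "active x = {i. \<bar>x $ i\<bar> = 1}"

text \<open>Keeping \<open>S\<close> as a parameter covers both polytopes at once:
  \<open>S = UNIV\<close> gives the cube itself, \<open>S = rg (transpose A)\<close> the
  section.\<close>

definition min_face :: "(real^'n) set \<Rightarrow> real^'n \<Rightarrow> (real^'n) set" where
  "min_face S x = {y \<in> hypercube \<inter> S. \<forall>i\<in>active x. y $ i = x $ i}"

lemma mem_hypercube_iff: "x \<in> hypercube \<longleftrightarrow> (\<forall>i. \<bar>x $ i\<bar> \<le> 1)"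
  by (auto simp: hypercube_def abs_le_iff)

lemma abs_less_one_of_not_active: "x \<in> hypercube \<Longrightarrow> i \<notin> active x \<Longrightarrow> \<bar>x $ i\<bar> < 1"
  by (metis active_def mem_Collect_eq mem_hypercube_iff order_less_le)

lemma convex_hypercube: "convex (hypercube :: (real^'n) set)"
proof -
  have "hypercube = cbox (\<chi> i. -1) (\<chi> i. 1)"
    by (auto simp: hypercube_def mem_box_cart)
  then show ?thesis by (metis convex_box(1))
qed

lemma mem_min_face: "x \<in> hypercube \<inter> S \<Longrightarrow> x \<in> min_face S x"
  by (auto simp: min_face_def)

text \<open>Both -1 and 1 are extreme points of [-1,1]. The value 1 forces equality in the triangle
  inequality, hence |a| = |b| = 1, and opposite signs would give |1 - 2u| < 1.\<close>

lemma convex_combination_abs_one: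
  fixes a b u :: real
  assumes "\<bar>a\<bar> \<le> 1" "\<bar>b\<bar> \<le> 1" "0 < u" "u < 1" "\<bar>(1 - u) * a + u * b\<bar> = 1"
  shows "a = (1 - u) * a + u * b \<and> b = (1 - u) * a + u * b"
proof -
  have le: "(1 - u) * \<bar>a\<bar> \<le> 1 - u" "u * \<bar>b\<bar> \<le> u"
    using assms by (auto simp: mult_left_le)
  have "\<bar>(1 - u) * a + u * b\<bar> \<le> (1 - u) * \<bar>a\<bar> + u * \<bar>b\<bar>"
    using assms abs_triangle_ineq[of "(1 - u) * a" "u * b"] by (simp add: abs_mult)
  with le assms have "(1 - u) * \<bar>a\<bar> = 1 - u" "u * \<bar>b\<bar> = u" by linarith+
  with assms have "\<bar>a\<bar> = 1" "\<bar>b\<bar> = 1" by auto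
  with assms show ?thesis by (auto simp: abs_if algebra_simps split: if_splits)
qed

lemma min_face_face_of:
  fixes x :: "real^'n"
  assumes S: "subspace S"
  shows "min_face S x face_of hypercube \<inter> S"
  unfolding face_of_def
proof (intro conjI ballI impI)
  show "min_face S x \<subseteq> hypercube \<inter> S" by (auto simp: min_face_def)
  have eq: "min_face S x = (hypercube \<inter> S) \<inter> (\<Inter>i\<in>active x. {y. y $ i = x $ i})"
    by (auto simp: min_face_def)
  have "convex {y :: real^'n. y $ i = x $ i}" for i
    by (auto simp: convex_def simp flip: distrib_right)
  then show "convex (min_face S x)"
    unfolding eq by (intro convex_Int convex_INT convex_hypercube subspace_imp_convex[OF S])
next
  fix a b y
  assume a: "a \<in> hypercube \<inter> S" and b: "b \<in> hypercube \<inter> S"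
    and y: "y \<in> min_face S x" and "y \<in> open_segment a b"
  then obtain u where u: "0 < u" "u < 1" and y_eq: "y = (1 - u) *\<^sub>R a + u *\<^sub>R b"
    by (auto simp: in_segment)
  have "a $ i = x $ i \<and> b $ i = x $ i" if "i \<in> active x" for i
  proof -
    have "\<bar>a $ i\<bar> \<le> 1" "\<bar>b $ i\<bar> \<le> 1" using a b by (auto simp: mem_hypercube_iff)
    moreover have "(1 - u) * a $ i + u * b $ i = x $ i"
      using y that by (simp add: min_face_def y_eq)
    ultimately show ?thesis
      using convex_combination_abs_one[of "a $ i" "b $ i" u] u that by (simp add: active_def)
  qed
  with a b show "a \<in> min_face S x" "b \<in> min_face S x"
    by (auto simp: min_face_def)
qed

text \<open>The constraints at inactive coordinates are strict at \<open>x\<close>, so they persist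
  on an open neighbourhood \<open>U\<close>. Near \<open>x\<close> the face therefore coincides with
  the affine space \<open>L\<close>, a translate of a subspace of \<open>S\<close>, and both claims
  can be read off from \<open>L\<close>.\<close>

lemma
  fixes x :: "real^'n"
  assumes S: "subspace S" and x: "x \<in> hypercube \<inter> S"
  shows mem_rel_interior_min_face: "x \<in> rel_interior (min_face S x)"
    and aff_dim_min_face:
      "aff_dim (min_face S x) = int (dim (S \<inter> {y. \<forall>i\<in>active x. y $ i = 0}))"
proof -
  let ?N = "{y :: real^'n. \<forall>i\<in>active x. y $ i = 0}"
  define L where "L = {y \<in> S. \<forall>i\<in>active x. y $ i = x $ i}"
  define U where "U = (\<Inter>i\<in>- active x. {y :: real^'n. \<bar>y $ i\<bar> < 1})"
  have K: "subspace (S \<inter> ?N)"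
    using S by (auto simp: subspace_def)
  have L: "L = (+) x ` (S \<inter> ?N)"
  proof (intro equalityI subsetI)
    fix y assume "y \<in> L"
    then have "y - x \<in> S \<inter> ?N" using x S by (auto simp: L_def subspace_diff)
    then show "y \<in> (+) x ` (S \<inter> ?N)" by (rule rev_image_eqI) simp
  qed (use x S in \<open>auto simp: L_def subspace_add\<close>)
  have "affine L" unfolding L
    using affine_translation subspace_imp_affine[OF K] by blast
  have "open U" unfolding U_def
    by (intro open_INT finite ballI open_Collect_less continuous_intros)
  have xLU: "x \<in> L \<inter> U"
    using x abs_less_one_of_not_active[of x] by (auto simp: L_def U_def)
  have LU: "L \<inter> U \<subseteq> min_face S x"
  proof
    fix y assume y: "y \<in> L \<inter> U"
    have "\<bar>y $ i\<bar> \<le> 1" for i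
      using y by (cases "i \<in> active x") (auto simp: L_def U_def active_def less_imp_le)
    with y show "y \<in> min_face S x" by (auto simp: min_face_def L_def mem_hypercube_iff)
  qed
  have "min_face S x \<subseteq> L" by (auto simp: min_face_def L_def)
  \<comment> \<open>A nonempty relatively open piece of \<open>L\<close> already spans
    \<open>L\<close>, and the face lies between such a piece and \<open>L\<close>.\<close>
  then have hull: "affine hull (min_face S x) = L"
    using affine_hull_affine_Int_open[OF \<open>affine L\<close> \<open>open U\<close>] xLU hull_mono[OF LU, of affine]
      hull_minimal[of "min_face S x" L affine] hull_same[of affine L] \<open>affine L\<close> by blast
  show "x \<in> rel_interior (min_face S x)"
    unfolding mem_rel_interior hull using \<open>open U\<close> xLU LU by blast
  have "aff_dim (min_face S x) = aff_dim L"
    by (metis aff_dim_affine_hull hull)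
  then show "aff_dim (min_face S x) = int (dim (S \<inter> ?N))"
    unfolding L aff_dim_translation_eq using K by (simp add: aff_dim_subspace)
qed

lemma sign_index_set_min_face:
  fixes x :: "real^'n"
  assumes "x \<in> hypercube \<inter> S"
  shows "sign_index_set (min_face S x) = active x"
proof (intro equalityI subsetI)
  fix i assume "i \<in> sign_index_set (min_face S x)"
  then show "i \<in> active x"
    using mem_min_face[OF assms] by (auto simp: sign_index_set_def active_def)
next
  fix i assume i: "i \<in> active x"
  then have "x $ i \<in> {-1, 1}" by (auto simp: active_def abs_if split: if_splits)
  with i show "i \<in> sign_index_set (min_face S x)"
    by (auto simp: sign_index_set_def min_face_def)
qed

text \<open>Two faces of a convex set whose relative interiors meet are equal; here both contain
  \<open>x\<close> in their relative interior.\<close>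

lemma face_eq_min_face:
  fixes x :: "real^'n"
  assumes S: "subspace S" and V: "V face_of hypercube \<inter> S" and x: "x \<in> rel_interior V"
  shows "V = min_face S x"
proof -
  have "x \<in> hypercube \<inter> S"
    using V x face_of_imp_subset rel_interior_subset by blast
  then show ?thesis
    using face_of_eq[OF V min_face_face_of[OF S]] mem_rel_interior_min_face[OF S] x by blast
qed

text \<open>
  The dimension is stated additively to avoid truncated subtraction. The sum of \<open>S\<close> and the
  coordinate subspace vanishing on \<open>I\<close> is the whole space by surjectivity, so the dimension
  formula for sums applies.
\<close>
lemma dim_subspace_vanishing:
  fixes S :: "(real^'n) set"
  assumes S: "subspace S" and surj: "\<And>t. \<exists>y\<in>S. \<forall>i\<in>I. y $ i = t i"
  shows "dim (S \<inter> {y. \<forall>i\<in>I. y $ i = 0}) + card I = dim S"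
proof -
  let ?N = "{y :: real^'n. \<forall>i\<in>I. y $ i = 0}"
  have N: "subspace ?N" by (auto simp: subspace_def)
  have "dim ?N = card (- I)"
    \<comment> \<open>The library lemma counts the coordinates left free, which are those outside
      \<open>I\<close>.\<close>
    using dim_substandard_cart[where 'a = real and d = "- I"] by (simp add: dim_vec_eq Ball_def)
  then have dim_N: "dim ?N + card I = CARD('n)"
    using card_Un_disjoint[of "- I" I] by (simp add: Compl_partition2)
  have "{x + y |x y. x \<in> S \<and> y \<in> ?N} = UNIV"
  proof (intro equalityI subsetI UNIV_I)
    fix z :: "real^'n"
    obtain y where y: "y \<in> S" "\<forall>i\<in>I. y $ i = z $ i" using surj[of "\<lambda>i. z $ i"] by blast
    then have "z = y + (z - y)" "z - y \<in> ?N" by auto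
    with y show "z \<in> {x + y |x y. x \<in> S \<and> y \<in> ?N}" by blast
  qed
  then have "CARD('n) + dim (S \<inter> ?N) = dim S + dim ?N"
    using dim_sums_Int[OF S N] by simp
  with dim_N show ?thesis by linarith
qed

section \<open>The range of the transpose\<close>

lemma subspace_rg: "subspace (rg B)"
  unfolding rg_def by (intro linear_subspace_image matrix_vector_mul_linear subspace_UNIV)

lemma dim_rg_transpose: "dim (rg (transpose A)) = rank (A :: real^'n^'m)"
  unfolding rg_def by (metis rank_dim_range rank_transpose)

lemma transpose_mult_component: "(transpose A *v w) $ i = column i A \<bullet> w"
  for A :: "real^'n^'m"
  by (simp add: matrix_vector_mul_component transpose_def column_def)

text \<open>A linear functional can take arbitrary values on independent columns, and every
  functional on the finite-dimensional space is an inner product with some w.\<close>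

lemma rg_transpose_surj:
  fixes A :: "real^'n^'m"
  assumes "columns_full_rank A I"
  shows "\<exists>y\<in>rg (transpose A). \<forall>i\<in>I. y $ i = t i"
proof -
  let ?c = "\<lambda>i. column i A"
  have inj: "inj_on ?c I" and ind: "independent (?c ` I)"
    using assms by (auto simp: columns_full_rank_def lin_indep_family_def)
  \<comment> \<open>The values \<open>t\<close> are indexed by \<open>I\<close> but must be
    prescribed on vectors; injectivity of the column map lets them be transported.\<close>
  from linear_independent_extend[OF ind, of "\<lambda>v. t (the_inv_into I ?c v)"]
  obtain f :: "real^'m \<Rightarrow> real" where f: "linear f"
    and fc: "\<And>i. i \<in> I \<Longrightarrow> f (?c i) = t i"
    by (auto simp: the_inv_into_f_f[OF inj])
  \<comment> \<open>The vector \<open>adjoint f 1\<close> represents \<open>f\<close> as an inner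
    product.\<close>
  have "(transpose A *v adjoint f 1) $ i = t i" if "i \<in> I" for i
    unfolding transpose_mult_component using adjoint_works[OF f, of "?c i" 1] fc[OF that] by simp
  then show ?thesis by (auto simp: rg_def)
qed

lemma card_le_rank_of_columns_full_rank:
  fixes A :: "real^'n^'m"
  assumes "columns_full_rank A I"
  shows "card I \<le> rank A"
  using dim_subspace_vanishing[OF subspace_rg rg_transpose_surj[OF assms]]
  by (simp add: dim_rg_transpose)

lemma rows_full_rank_transpose: "rows_full_rank (transpose A) I \<longleftrightarrow> columns_full_rank A I"
  by (simp add: rows_full_rank_def columns_full_rank_def)

lemma supnorm_on_less_iff: "0 < c \<Longrightarrow> supnorm_on J v < c \<longleftrightarrow> (\<forall>i\<in>J. \<bar>v $ i\<bar> < c)"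
  by (simp add: supnorm_on_def)

lemma aff_dim_min_face_UNIV:
  fixes x :: "real^'n"
  assumes "x \<in> hypercube"
  shows "aff_dim (min_face UNIV x) + int (card (active x)) = int CARD('n)"
proof -
  have "\<exists>y\<in>UNIV. \<forall>i\<in>active x. y $ i = t i" for t :: "'n \<Rightarrow> real"
    by (rule bexI[of _ "\<chi> i. t i"]) auto
  from dim_subspace_vanishing[OF subspace_UNIV this]
  show ?thesis
    using aff_dim_min_face[OF subspace_UNIV, of x] assms by simp
qed

lemma aff_dim_min_face_rg:
  fixes A :: "real^'n^'m"
  assumes "x \<in> hypercube \<inter> rg (transpose A)" and "columns_full_rank A (active x)"
  shows "aff_dim (min_face (rg (transpose A)) x) + int (card (active x)) = int (rank A)"
  using dim_subspace_vanishing[OF subspace_rg rg_transpose_surj[OF assms(2)]]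
    aff_dim_min_face[OF subspace_rg assms(1)]
  by (simp add: dim_rg_transpose)

section \<open>Reduction of each statement to a point of the section\<close>

definition has_active_point :: "real^'n^'m \<Rightarrow> nat \<Rightarrow> bool" where
  "has_active_point A k \<longleftrightarrow>
     (\<exists>x\<in>hypercube \<inter> rg (transpose A). card (active x) = k \<and> columns_full_rank A (active x))"

lemma recoverable_support_iff_active_point:
  fixes A :: "real^'n^'m"
  shows "(\<exists>I s. recoverable_support A I s \<and> card I = k) \<longleftrightarrow> has_active_point A k"
proof
  assume "\<exists>I s. recoverable_support A I s \<and> card I = k"
  then obtain I s where "recoverable_support A I s" and card: "card I = k" by blast
  then obtain w where s: "s \<in> I \<rightarrow>\<^sub>E {-1, 1}" and full: "columns_full_rank A I"
    and eq: "\<And>i. i \<in> I \<Longrightarrow> (transpose A *v w) $ i = s i"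
    and less: "\<And>i. i \<notin> I \<Longrightarrow> \<bar>(transpose A *v w) $ i\<bar> < 1"
    by (auto simp: recoverable_support_def supnorm_on_less_iff)
  let ?x = "transpose A *v w"
  have one: "\<bar>?x $ i\<bar> = 1" if "i \<in> I" for i
    using PiE_mem[OF s that] eq[OF that] by auto
  have "active ?x = I"
    using one less by (force simp: active_def)
  moreover have "?x \<in> hypercube"
    unfolding mem_hypercube_iff using one less by (metis less_imp_le order_refl)
  moreover have "?x \<in> rg (transpose A)" by (auto simp: rg_def)
  ultimately show "has_active_point A k"
    using full card unfolding has_active_point_def by (intro bexI[of _ ?x]) auto
next
  assume "has_active_point A k"
  then obtain w where cube: "transpose A *v w \<in> hypercube"
    and card: "card (active (transpose A *v w)) = k"
    and full: "columns_full_rank A (active (transpose A *v w))"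
    by (auto simp: has_active_point_def rg_def)
  let ?x = "transpose A *v w"
  \<comment> \<open>The sign vector must be \<open>undefined\<close> outside its index set to belong
    to the extensional function space.\<close>
  have "restrict (($) ?x) (active ?x) \<in> active ?x \<rightarrow>\<^sub>E {-1, 1}"
    by (auto simp: active_def abs_if split: if_splits)
  moreover have "supnorm_on (- active ?x) ?x < 1"
    using abs_less_one_of_not_active[OF cube] by (simp add: supnorm_on_less_iff)
  \<comment> \<open>The size bound comes from independence: |I| \<le> rank A \<le> m.\<close>
  moreover have "card (active ?x) \<le> CARD('m)"
    using card_le_rank_of_columns_full_rank[OF full] rank_bound[of A] by simp
  ultimately have "recoverable_support A (active ?x) (restrict (($) ?x) (active ?x))"
    using full unfolding recoverable_support_def by (intro conjI exI[of _ w]) auto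
  with card show "\<exists>I s. recoverable_support A I s \<and> card I = k" by blast
qed

lemma cube_face_iff_active_point:
  fixes A :: "real^'n^'m"
  assumes "k \<le> rank A"
  shows "(\<exists>F \<in> faces_of_dim (CARD('n) - k) (hypercube :: (real^'n) set).
           rel_interior F \<inter> rg (transpose A) \<noteq> {} \<and>
           rows_full_rank (transpose A) (sign_index_set F)) \<longleftrightarrow> has_active_point A k"
    (is "?L \<longleftrightarrow> _")
proof
  \<comment> \<open>This ensures that the natural number \<open>CARD('n) - k\<close> is not
    truncated.\<close>
  have k: "k \<le> CARD('n)" using assms rank_bound[of A] by simp
  {
    assume ?L
    then obtain F x where F: "F face_of (hypercube :: (real^'n) set)"
      and dim: "aff_dim F = int (CARD('n) - k)" and x: "x \<in> rel_interior F"
      and rg: "x \<in> rg (transpose A)" and full: "columns_full_rank A (sign_index_set F)"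
      by (auto simp: faces_of_dim_def rows_full_rank_transpose)
    have cube: "x \<in> hypercube"
      using F x face_of_imp_subset rel_interior_subset by blast
    have F_eq: "F = min_face UNIV x"
      using face_eq_min_face[OF subspace_UNIV _ x] F by simp
    have "card (active x) = k"
      using aff_dim_min_face_UNIV[OF cube] dim k by (simp add: F_eq)
    moreover have "columns_full_rank A (active x)"
      using full sign_index_set_min_face[of x UNIV] cube by (simp add: F_eq)
    ultimately show "has_active_point A k"
      using cube rg by (auto simp: has_active_point_def)
  }
  {
    assume "has_active_point A k"
    then obtain x where cube: "x \<in> hypercube" and rg: "x \<in> rg (transpose A)"
      and card: "card (active x) = k" and full: "columns_full_rank A (active x)"
      by (auto simp: has_active_point_def)
    have "min_face UNIV x \<in> faces_of_dim (CARD('n) - k) hypercube"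
      using min_face_face_of[OF subspace_UNIV, of x] aff_dim_min_face_UNIV[OF cube] card k
      by (simp add: faces_of_dim_def)
    moreover have "x \<in> rel_interior (min_face UNIV x)"
      using mem_rel_interior_min_face[OF subspace_UNIV] cube by simp
    moreover have "rows_full_rank (transpose A) (sign_index_set (min_face UNIV x))"
      using full sign_index_set_min_face[of x UNIV] cube by (simp add: rows_full_rank_transpose)
    ultimately show ?L using rg by blast
  }
qed

lemma section_face_iff_active_point:
  fixes A :: "real^'n^'m"
  assumes k: "k \<le> rank A"
  shows "(\<exists>V \<in> faces_of_dim (rank A - k) (hypercube \<inter> rg (transpose A)). \<exists>v\<in>V.
           supnorm_on (- sign_index_set V) v < 1 \<and>
           columns_full_rank A (sign_index_set V)) \<longleftrightarrow> has_active_point A k"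
    (is "?L \<longleftrightarrow> _")
proof
  let ?R = "rg (transpose A)"
  {
    assume ?L
    then obtain V v where V: "V face_of hypercube \<inter> ?R"
      and dim: "aff_dim V = int (rank A - k)" and "v \<in> V"
      and full: "columns_full_rank A (sign_index_set V)"
      by (auto simp: faces_of_dim_def)
    \<comment> \<open>The given \<open>v\<close> shows that \<open>V\<close> is nonempty, so the
      convex set \<open>V\<close> has a relative interior point \<open>x\<close>, which determines
      \<open>V\<close>. Conversely, \<open>x\<close> itself later serves as
      \<open>v\<close>.\<close>
    then obtain x where x: "x \<in> rel_interior V"
      using rel_interior_eq_empty[OF face_of_imp_convex[OF V]] by blast
    have cube: "x \<in> hypercube \<inter> ?R"
      using V x face_of_imp_subset rel_interior_subset by blast
    have V_eq: "V = min_face ?R x"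
      using face_eq_min_face[OF subspace_rg V x] .
    have full': "columns_full_rank A (active x)"
      using full sign_index_set_min_face[OF cube] by (simp add: V_eq)
    moreover have "card (active x) = k"
      using aff_dim_min_face_rg[OF cube full'] dim k by (simp add: V_eq)
    ultimately show "has_active_point A k"
      using cube by (auto simp: has_active_point_def)
  }
  {
    assume "has_active_point A k"
    then obtain x where cube: "x \<in> hypercube \<inter> ?R"
      and card: "card (active x) = k" and full: "columns_full_rank A (active x)"
      by (auto simp: has_active_point_def)
    have "min_face ?R x \<in> faces_of_dim (rank A - k) (hypercube \<inter> ?R)"
      using min_face_face_of[OF subspace_rg] aff_dim_min_face_rg[OF cube full] card k
      by (simp add: faces_of_dim_def)
    moreover have "supnorm_on (- active x) x < 1"
      using abs_less_one_of_not_active[of x] cube by (simp add: supnorm_on_less_iff)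
    ultimately show ?L
      using full mem_min_face[OF cube] sign_index_set_min_face[OF cube]
      by (intro bexI[of _ "min_face ?R x"] bexI[of _ x]) auto
  }
qed

theorem theorem10:
  fixes A :: "real^'n^'m" and l k :: nat
  assumes "CARD('m) \<le> CARD('n)"
    and "rank A = l"
    and "k \<le> l"
  shows
    "((\<exists>I s. recoverable_support A I s \<and> card I = k) \<longleftrightarrow>
      (\<exists>F \<in> faces_of_dim (CARD('n) - k) (hypercube :: (real^'n) set).
         rel_interior F \<inter> rg (transpose A) \<noteq> {} \<and>
         rows_full_rank (transpose A) (sign_index_set F)))
   \<and> ((\<exists>F \<in> faces_of_dim (CARD('n) - k) (hypercube :: (real^'n) set).
         rel_interior F \<inter> rg (transpose A) \<noteq> {} \<and>
         rows_full_rank (transpose A) (sign_index_set F)) \<longleftrightarrow>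
      (\<exists>V \<in> faces_of_dim (l - k) (hypercube \<inter> rg (transpose A)). \<exists>v\<in>V.
         supnorm_on (- sign_index_set V) v < 1 \<and>
         columns_full_rank A (sign_index_set V)))"
proof -
  have k: "k \<le> rank A" using assms by simp
  show ?thesis
    unfolding recoverable_support_iff_active_point cube_face_iff_active_point[OF k]
      section_face_iff_active_point[OF k, unfolded assms(2)] by simp
qed

end
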